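(* Let $\mathbb{P}$ be the phase hyperfield and let $f:\mathbb{C}\to\mathbb{P}$ be the hyperfield homomorphism with $f(0)=0$ and $f(z)=z/|z|$ for $z\neq0$. Let $$\overline{p}(T)=T^3+e^{i\pi/24}T^2+e^{i\pi/2}T+e^{23i\pi/24},$$ a polynomial over $\mathbb{P}$. Then $\mathrm{mult}_{-1}(\overline{p})=2$, and for every polynomial $p\in\mathbb{C}[T]$ corresponding to $\overline{p}$ with respect to $f$ (that is, $p(T)=c_3T^3+c_2T^2+c_1T+c_0$ with $f(c_3)=1$, $f(c_2)=e^{i\pi/24}$, $f(c_1)=e^{i\pi/2}$, $f(c_0)=e^{23i\pi/24}$) one has $$\mathrm{mult}_{-1}(\overline{p})=2>\sum_{a\in\mathbb{R},\ a<0}\mathrm{mult}_a(p).$$ In particular, the inequality $\mathrm{mult}_b(\overline{p})\ge\sum_{a\in f^{-1}(b)}\mathrm{mult}_a(p)$ is not sharp under $f:\mathbb{C}\to\mathbb{P}$: for this $\overline{p}$ and $b=-1$, no corresponding polynomial $p$ attains equality.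
   Context: The phase hyperfield $\mathbb{P}$ is the set $S^1\cup\{0\}$, $S^1=\{z\in\mathbb{C}:|z|=1\}$, with the usual multiplication and the commutative hyperaddition given by $x\boxplus 0=\{x\}$; $x\boxplus(-x)=\{0,x,-x\}$; and otherwise $x\boxplus y=\left\{\frac{\alpha x+\beta y}{|\alpha x+\beta y|}:\alpha,\beta\in\mathbb{R}_{>0}\right\}$. For subsets, $A\boxplus B=\bigcup_{a\in A,b\in B}a\boxplus b$, and iterated hypersums are defined accordingly. A polynomial over a hyperfield $\mathbb{F}$ is a formal expression $p(T)=c_nT^n+\cdots+c_1T+c_0$ with $c_i\in\mathbb{F}$, $c_n\ne0$ (degree $n$). For polynomials $p=\sum_{k\le n} c_kT^k$ and $q=\sum_{l\le m} d_lT^l$, the product $p\boxdot q$ is the set of all $\sum_{i=0}^{n+m}e_iT^i$ with $e_i\in\boxplus_{k+l=i}c_kd_l$ for every $i$. An element $a\in\mathbb{F}$ is a root of $p$ if $0\in c_na^n\boxplus\cdots\boxplus c_1a\boxplus c_0$ (equivalently, $p\in(T-a)\boxdot q$ for some polynomial $q$ over $\mathbb{F}$). The multiplicity is defined recursively: $\mathrm{mult}_a(p)=0$ if $a$ is not a root of $p$, and otherwise $\mathrm{mult}_a(p)=1+\max\{\mathrm{mult}_a(q): p\in(T-a)\boxdot q\}$. For a field (viewed as a hyperfield with $x\boxplus y=\{x+y\}$) this is the usual multiplicity of a root. *)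

theory Defs
  imports Complex_Main "HOL-Computational_Algebra.Polynomial"
begin

section \<open>Hyperfields\<close>

class hyperfield = zero_neq_one + comm_monoid_mult + mult_zero + uminus +
  fixes hyperadd :: "'a \<Rightarrow> 'a \<Rightarrow> 'a set"  (infixl "\<boxplus>" 65)
  assumes hyperadd_nonempty: "x \<boxplus> y \<noteq> {}"
    and hyperadd_commute: "x \<boxplus> y = y \<boxplus> x"
    and hyperadd_assoc: "(\<Union>w\<in>x \<boxplus> y. w \<boxplus> z) = (\<Union>w\<in>y \<boxplus> z. x \<boxplus> w)"
    and hyperadd_0_right: "x \<boxplus> 0 = {x}"
    and zero_in_hyperadd_iff: "0 \<in> x \<boxplus> y \<longleftrightarrow> y = - x"
    and hyperadd_reversible: "z \<in> x \<boxplus> y \<Longrightarrow> y \<in> z \<boxplus> (- x)"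
    and hyperadd_distrib: "(\<lambda>w. c * w) ` (x \<boxplus> y) = (c * x) \<boxplus> (c * y)"
    and unit_exists: "x \<noteq> 0 \<Longrightarrow> \<exists>y. x * y = 1"

definition hyperfield_hom :: "('a::hyperfield \<Rightarrow> 'b::hyperfield) \<Rightarrow> bool" where
  "hyperfield_hom f \<longleftrightarrow> f 0 = 0 \<and> f 1 = 1 \<and> (\<forall>x y. f (x * y) = f x * f y) \<and>
     (\<forall>x y. f ` (x \<boxplus> y) \<subseteq> f x \<boxplus> f y)"

text \<open>The bracketing is immaterial by associativity, and a summand 0 changes nothing.\<close>

fun hypersum :: "'a::hyperfield list \<Rightarrow> 'a set" where
  "hypersum [] = {0}"
| "hypersum (x # xs) = (\<Union>y\<in>hypersum xs. x \<boxplus> y)"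


section \<open>Polynomials over a hyperfield: products, roots, multiplicities\<close>

text \<open>The type \<open>'a poly\<close> only serves as the type of finitely supported coefficient sequences.
  Coefficients beyond the degree are 0, so that the condition for
  \<open>i > degree p + degree q\<close> says that \<open>r\<close> has coefficient 0 there.\<close>

definition hyperprod :: "'a::hyperfield poly \<Rightarrow> 'a poly \<Rightarrow> 'a poly set"  (infixl "\<boxdot>" 70) where
  "p \<boxdot> q = {r. \<forall>i. coeff r i \<in> hypersum (map (\<lambda>k. coeff p k * coeff q (i - k)) [0..<Suc i])}"

definition hyperroot :: "'a::hyperfield poly \<Rightarrow> 'a \<Rightarrow> bool" where
  "hyperroot p a \<longleftrightarrow> 0 \<in> hypersum (map (\<lambda>k. coeff p k * a ^ k) [0..<Suc (degree p)])"

lemma hyperadd_0_left [simp]: "0 \<boxplus> x = {x :: 'a :: hyperfield}"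
  using hyperadd_commute hyperadd_0_right by metis

declare hyperadd_0_right [simp]

lemma hypersum_zeros: "(\<And>x. x \<in> set xs \<Longrightarrow> x = 0) \<Longrightarrow> hypersum xs = {0}"
  by (induction xs) auto

lemma map_coeff_linear:
  fixes q :: "'a :: hyperfield poly"
  shows "hypersum (map (\<lambda>k. coeff [:b, 1:] k * coeff q (i - k)) [0..<Suc i]) =
    (if i = 0 then {b * coeff q 0} else (b * coeff q i) \<boxplus> coeff q (i - 1))"
proof (cases i)
  case (Suc j)
  have "[0..<Suc i] = 0 # 1 # [2..<Suc i]"
    using Suc by (simp add: upt_rec numeral_2_eq_2)
  moreover have "hypersum (map (\<lambda>k. coeff [:b, 1:] k * coeff q (i - k)) [2..<Suc i]) = {0}"
    by (rule hypersum_zeros)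
       (auto simp: coeff_pCons numeral_2_eq_2 split: nat.splits)
  ultimately show ?thesis using Suc by (simp del: upt_Suc)
qed simp

lemma hyperprod_linear_degree:
  fixes p q :: "'a :: hyperfield poly"
  assumes "p \<in> [:b, 1:] \<boxdot> q" "p \<noteq> 0"
  shows "degree p = Suc (degree q)"
proof -
  have *: "coeff p (Suc i) \<in> (b * coeff q (Suc i)) \<boxplus> coeff q i" for i
    using assms(1) map_coeff_linear[of b q "Suc i"] unfolding hyperprod_def
    by (simp del: upt_Suc) (metis diff_Suc_1)
  have q: "q \<noteq> 0"
  proof
    assume "q = 0"
    have "coeff p i = 0" for i
      using assms(1) \<open>q = 0\<close> hypersum_zeros unfolding hyperprod_def
      by (smt (verit) coeff_0 imageE list.set_map mem_Collect_eq mult_zero_right singletonD)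
    thus False using assms(2) by (simp add: poly_eq_iff)
  qed
  show ?thesis
  proof (rule antisym)
    show "degree p \<le> Suc (degree q)"
    proof (rule degree_le, intro allI impI)
      fix i assume i: "Suc (degree q) < i"
      then obtain j where "i = Suc j" "degree q < j" by (cases i) auto
      with *[of j] show "coeff p i = 0" by (simp add: coeff_eq_0)
    qed
    have "coeff p (Suc (degree q)) = lead_coeff q"
      using *[of "degree q"] by (simp add: coeff_eq_0)
    thus "Suc (degree q) \<le> degree p" using q by (intro le_degree) simp
  qed
qed

text \<open>The zero polynomial is not a polynomial over a hyperfield in the sense used here (the leading
  coefficient is nonzero); it is given the dummy multiplicity 0. If \<open>p \<noteq> 0\<close>, every \<open>q\<close> below is
  nonzero. The set under \<open>Max\<close> is finite and nonempty, by lemmas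
  \<open>finite_hmult_image\<close> and \<open>hyperroot_imp_factor\<close>.\<close>

function hmult :: "'a::hyperfield \<Rightarrow> 'a poly \<Rightarrow> nat" where
  "hmult a p = (if p \<noteq> 0 \<and> hyperroot p a
                then 1 + Max (hmult a ` {q. p \<in> [:- a, 1:] \<boxdot> q}) else 0)"
  by pat_completeness auto
termination
  by (relation "measure (\<lambda>(a, p). degree p)") (auto dest: hyperprod_linear_degree)

declare hmult.simps [simp del]

lemma hyperprod_linear_iff:
  fixes p q :: "'a :: hyperfield poly"
  shows "p \<in> [:b, 1:] \<boxdot> q \<longleftrightarrow>
    coeff p 0 = b * coeff q 0 \<and> (\<forall>i. coeff p (Suc i) \<in> (b * coeff q (Suc i)) \<boxplus> coeff q i)"
  (is "_ \<longleftrightarrow> ?R")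
proof -
  have all_nat: "(\<forall>i. P i) \<longleftrightarrow> P 0 \<and> (\<forall>i. P (Suc i))" for P :: "nat \<Rightarrow> bool"
    by (metis not0_implies_Suc)
  have "p \<in> [:b, 1:] \<boxdot> q \<longleftrightarrow> (\<forall>i. coeff p i \<in>
     (if i = 0 then {b * coeff q 0} else (b * coeff q i) \<boxplus> coeff q (i - 1)))"
    unfolding hyperprod_def mem_Collect_eq map_coeff_linear ..
  also have "\<dots> \<longleftrightarrow> ?R"
    using all_nat[of "\<lambda>i. coeff p i \<in>
     (if i = 0 then {b * coeff q 0} else (b * coeff q i) \<boxplus> coeff q (i - 1))"] by simp
  finally show ?thesis .
qed


subsection \<open>The maximum in the definition of the multiplicity exists\<close>

lemma hyperfield_minus_0 [simp]: "- 0 = (0 :: 'a :: hyperfield)"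
  using zero_in_hyperadd_iff[of 0 "0 :: 'a"] by simp

lemma hyperfield_mult_minus: "x * (- y) = - (x * y :: 'a :: hyperfield)"
proof -
  have "0 \<in> y \<boxplus> (- y)" by (simp add: zero_in_hyperadd_iff)
  hence "x * 0 \<in> (\<lambda>w. x * w) ` (y \<boxplus> (- y))" by (rule imageI)
  thus ?thesis by (simp add: hyperadd_distrib zero_in_hyperadd_iff)
qed

lemma hypersum_witness:
  "y \<in> hypersum xs \<Longrightarrow>
     \<exists>s. s 0 = y \<and> s (length xs) = 0 \<and> (\<forall>k<length xs. s k \<in> xs ! k \<boxplus> s (Suc k))"
proof (induction xs arbitrary: y)
  case (Cons x xs)
  then obtain z where z: "z \<in> hypersum xs" "y \<in> x \<boxplus> z" by auto
  from Cons.IH[OF z(1)] obtain s where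
    s: "s 0 = z" "s (length xs) = 0" "\<forall>k<length xs. s k \<in> xs ! k \<boxplus> s (Suc k)" by blast
  show ?case
    by (rule exI[of _ "case_nat y s"]) (use s z in \<open>auto simp: nth_Cons split: nat.splits\<close>)
qed auto

lemma hyperroot_imp_factor:
  fixes p :: "'a :: hyperfield poly"
  assumes "hyperroot p a"
  shows "\<exists>q. p \<in> [:- a, 1:] \<boxdot> q"
proof -
  define n where "n = degree p"
  obtain s where s0: "s 0 = 0" and sn: "s (Suc n) = 0"
    and s: "\<And>k. k \<le> n \<Longrightarrow> s k \<in> coeff p k * a ^ k \<boxplus> s (Suc k)"
    using hypersum_witness[OF assms[unfolded hyperroot_def]] unfolding n_def
    by (auto simp del: upt_Suc simp: less_Suc_eq_le)
  show ?thesis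
  proof (cases "a = 0")
    case True
    have zero_pow: "(0 :: 'a) ^ k = 0" if "Suc 0 \<le> k" for k
      using that by (cases k) auto
    have "coeff p 0 = 0"
    proof -
      have "hypersum (map (\<lambda>k. coeff p k * a ^ k) [Suc 0..<Suc n]) = {0}"
        using True zero_pow by (intro hypersum_zeros) auto
      moreover have "[0..<Suc n] = 0 # [Suc 0..<Suc n]" by (simp add: upt_rec)
      ultimately show ?thesis
        using assms unfolding hyperroot_def n_def by (simp del: upt_Suc)
    qed
    hence "p \<in> [:- a, 1:] \<boxdot> Poly (map (\<lambda>k. coeff p (Suc k)) [0..<Suc n])"
      using True unfolding hyperprod_linear_iff
      by (auto simp: nth_default_def coeff_eq_0 n_def simp del: upt_Suc)
    thus ?thesis by blast
  next
    case False
    then obtain b where b: "a * b = 1" using unit_exists by blast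
    have ab: "a ^ k * b ^ k = 1" for k
      using b by (metis power_mult_distrib power_one)
    define q where "q = Poly (map (\<lambda>k. b ^ Suc k * s (Suc k)) [0..<n])"
    have q: "coeff q k = b ^ Suc k * s (Suc k)" if "k \<le> n" for k
      using that sn by (cases "k = n") (auto simp: q_def nth_default_def)
    have q0: "coeff q k = 0" if "k \<ge> n" for k
      using that by (auto simp: q_def nth_default_def)
    have aq: "- a * coeff q k = - (b ^ k * s (Suc k))" if "k \<le> n" for k
    proof -
      have "a * coeff q k = (a * b) * (b ^ k * s (Suc k))"
        using q[OF that] by (simp add: ac_simps)
      thus ?thesis using b hyperfield_mult_minus[of "coeff q k" a] by (simp add: mult.commute)
    qed
    have key: "coeff p k \<in> b ^ k * s k \<boxplus> (- (b ^ k * s (Suc k)))" if "k \<le> n" for k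
    proof -
      have "s k \<in> s (Suc k) \<boxplus> coeff p k * a ^ k"
        using s[OF that] by (simp add: hyperadd_commute)
      hence "coeff p k * a ^ k \<in> s k \<boxplus> (- s (Suc k))" by (rule hyperadd_reversible)
      hence "b ^ k * (coeff p k * a ^ k) \<in> (\<lambda>w. b ^ k * w) ` (s k \<boxplus> (- s (Suc k)))"
        by (rule imageI)
      moreover have "b ^ k * (coeff p k * a ^ k) = coeff p k"
        using ab[of k] by (metis mult.assoc mult.commute mult.right_neutral)
      ultimately show ?thesis by (simp add: hyperadd_distrib hyperfield_mult_minus)
    qed
    have "p \<in> [:- a, 1:] \<boxdot> q"
      unfolding hyperprod_linear_iff
    proof (intro conjI allI)
      show "coeff p 0 = - a * coeff q 0" using key[of 0] aq[of 0] s0 by simp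
      fix i
      show "coeff p (Suc i) \<in> - a * coeff q (Suc i) \<boxplus> coeff q i"
      proof (cases "Suc i \<le> n")
        case True
        thus ?thesis using key[of "Suc i"] aq[of "Suc i"] q[of i] by (simp add: hyperadd_commute)
      next
        case False
        thus ?thesis using q0[of i] q0[of "Suc i"] by (simp add: coeff_eq_0 n_def)
      qed
    qed
    thus ?thesis by blast
  qed
qed

lemma hmult_le_degree: "hmult a p \<le> degree p"
  and finite_hmult_image: "p \<noteq> 0 \<Longrightarrow> finite (hmult a ` {q. p \<in> [:- a, 1:] \<boxdot> q})"
proof -
  have fin: "finite (hmult a ` {q. p \<in> [:- a, 1:] \<boxdot> q})"
    if "\<And>q. degree q < degree p \<Longrightarrow> hmult a q \<le> degree q" "p \<noteq> 0" for p
    by (rule finite_subset[of _ "{..degree p}"])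
       (use that hyperprod_linear_degree in \<open>fastforce+\<close>)
  have le: "hmult a p \<le> degree p" for p
  proof (induction "degree p" arbitrary: p rule: less_induct)
    case less
    show ?case
    proof (cases "p \<noteq> 0 \<and> hyperroot p a")
      case True
      let ?S = "hmult a ` {q. p \<in> [:- a, 1:] \<boxdot> q}"
      have "finite ?S" using fin less True by blast
      moreover have "?S \<noteq> {}" using hyperroot_imp_factor True by blast
      moreover have "Suc m \<le> degree p" if "m \<in> ?S" for m
        using that less hyperprod_linear_degree True by fastforce
      ultimately have "Suc (Max ?S) \<le> degree p" using Max_in by blast
      thus ?thesis using True by (subst hmult.simps) simp
    qed (subst hmult.simps, auto)
  qed
  show "hmult a p \<le> degree p" by (rule le)
  show "finite (hmult a ` {q. p \<in> [:- a, 1:] \<boxdot> q})" if "p \<noteq> 0"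
    using fin that le by blast
qed


section \<open>The field of complex numbers as a hyperfield\<close>

instantiation complex :: hyperfield
begin
definition hyperadd_complex :: "complex \<Rightarrow> complex \<Rightarrow> complex set" where
  "hyperadd_complex x y = {x + y}"
instance
  by standard (auto simp: hyperadd_complex_def algebra_simps eq_neg_iff_add_eq_0
      intro: right_inverse exI[of _ "inverse _"])
end

lemma hypersum_complex: "hypersum xs = {sum_list xs :: complex}"
  by (induction xs) (auto simp: hyperadd_complex_def)

lemma hyperroot_complex: "hyperroot p a \<longleftrightarrow> poly p (a :: complex) = 0"
proof -
  have "sum_list (map (\<lambda>k. coeff p k * a ^ k) [0..<Suc (degree p)]) = poly p a"
    by (simp add: poly_altdef interv_sum_list_conv_sum_set_nat atLeast0LessThan lessThan_Suc_atMost
        del: upt_Suc)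
  thus ?thesis by (auto simp: hyperroot_def hypersum_complex simp del: upt_Suc)
qed

lemma hyperprod_complex: "p \<in> [:- a, 1:] \<boxdot> q \<longleftrightarrow> p = [:- a, 1 :: complex:] * q"
  unfolding hyperprod_linear_iff poly_eq_iff
  by (auto simp: hyperadd_complex_def coeff_pCons split: nat.splits)

lemma hmult_complex: "p \<noteq> 0 \<Longrightarrow> hmult a p = order (a :: complex) p"
proof (induction "degree p" arbitrary: p rule: less_induct)
  case less
  show ?case
  proof (cases "poly p a = 0")
    case True
    then obtain q where q: "p = [:- a, 1:] * q" by (auto simp: poly_eq_0_iff_dvd)
    hence "q \<noteq> 0" using less.prems by auto
    have "{q'. p \<in> [:- a, 1:] \<boxdot> q'} = {q}"
      unfolding hyperprod_complex q by (auto simp del: mult_pCons_left)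
    moreover have "hmult a q = order a q"
      using less.hyps[of q] \<open>q \<noteq> 0\<close> q by (simp add: degree_mult_eq del: mult_pCons_left)
    moreover have "order a p = 1 + order a q"
      using less.prems order_power_n_n[of a 1] unfolding q by (subst order_mult) auto
    ultimately show ?thesis
      using True less.prems by (subst hmult.simps) (simp add: hyperroot_complex)
  next
    case False
    thus ?thesis by (subst hmult.simps) (simp add: hyperroot_complex order_0I)
  qed
qed


section \<open>The phase hyperfield\<close>

typedef phase = "{z :: complex. z = 0 \<or> cmod z = 1}"
  by auto

setup_lifting type_definition_phase

text \<open>\<open>phase_of\<close> is the map \<open>f : \<complex> \<rightarrow> \<P>\<close>; lemma \<open>hyperfield_hom_phase_of\<close> below shows that it is
  a homomorphism. \<open>phase_cis t\<close> is the element \<open>e\<^bsup>it\<^esup>\<close> of \<open>\<P>\<close>.\<close>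

lift_definition phase_of :: "complex \<Rightarrow> phase" is "\<lambda>z. if z = 0 then 0 else z / of_real (cmod z)"
  by (auto simp: norm_divide)

lift_definition phase_cis :: "real \<Rightarrow> phase" is cis
  by simp

instantiation phase :: hyperfield
begin

lift_definition zero_phase :: phase is 0 by simp
lift_definition one_phase :: phase is 1 by simp
lift_definition uminus_phase :: "phase \<Rightarrow> phase" is uminus by auto
lift_definition times_phase :: "phase \<Rightarrow> phase \<Rightarrow> phase" is "(*)" by (auto simp: norm_mult)

definition hyperadd_phase :: "phase \<Rightarrow> phase \<Rightarrow> phase set" where
  "hyperadd_phase x y =
     (if y = 0 then {x} else if x = 0 then {y}
      else if y = - x then {0, x, - x}
      else {z. \<exists>\<alpha> \<beta> :: real. \<alpha> > 0 \<and> \<beta> > 0 \<and>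
              Rep_phase z = (of_real \<alpha> * Rep_phase x + of_real \<beta> * Rep_phase y) /
                of_real (cmod (of_real \<alpha> * Rep_phase x + of_real \<beta> * Rep_phase y))})"

instance proof
  define f where "f = phase_of"
  define R where "R = Rep_phase"
  have R_0: "R x = 0 \<longleftrightarrow> x = 0" for x
    unfolding R_def by transfer simp
  have R_norm: "cmod (R x) = 1" if "x \<noteq> 0" for x
    using that unfolding R_def by transfer auto
  have R_mult: "R (x * y) = R x * R y" and R_minus: "R (- x) = - R x" for x y
    unfolding R_def by (simp_all add: times_phase.rep_eq uminus_phase.rep_eq)
  have R_inj: "x = y" if "R x = R y" for x y
    using that unfolding R_def by (simp add: Rep_phase_inject)
  have Rf: "R (f z) = (if z = 0 then 0 else z / of_real (cmod z))" for z
    unfolding R_def f_def by (simp add: phase_of.rep_eq)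
  have fR: "f (R x) = x" for x
    by (rule R_inj) (auto simp: Rf R_norm R_0)
  have f_scale: "f (of_real c * z) = f z" if "c > 0" for c z
    by (rule R_inj) (use that in \<open>auto simp: Rf norm_mult\<close>)
  have f_0: "f z = 0 \<longleftrightarrow> z = 0" for z
    unfolding R_0[symmetric] Rf by simp
  have f_polar: "z = of_real (cmod z) * R (f z)" for z
    by (auto simp: Rf)
  have f_same: "\<exists>c>0. w = of_real c * z" if "f w = f z" "f z \<noteq> 0" for w z
  proof -
    have "z \<noteq> 0" "w \<noteq> 0" using that f_0 by metis+
    moreover have "w = of_real (cmod w / cmod z) * z"
    proof -
      have "of_real (cmod w / cmod z) * z = of_real (cmod w / cmod z) * (of_real (cmod z) * R (f z))"
        using f_polar[of z] by simp
      also have "\<dots> = of_real (cmod w) * R (f w)"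
        using \<open>z \<noteq> 0\<close> that by simp
      also have "\<dots> = w" using f_polar[of w] by simp
      finally show ?thesis ..
    qed
    ultimately show ?thesis by (intro exI[of _ "cmod w / cmod z"]) simp
  qed
  have f_mult: "f (u * v) = f u * f v" for u v
    by (rule R_inj) (auto simp: R_mult Rf norm_mult)
  have f_minus: "f (- u) = - f u" for u
    by (rule R_inj) (auto simp: R_minus Rf)
  have ex_f: "f u = x \<and> x \<noteq> 0 \<longleftrightarrow> x \<noteq> 0 \<and> (\<exists>c>0. u = of_real c * R x)" for u x
    using f_same[of u "R x"] fR[of x] f_scale by auto
  have add: "x \<boxplus> y = {f (u + v) | u v. f u = x \<and> f v = y}" for x y
  proof (cases "x = 0 \<or> y = 0")
    case True
    have "{f (u + v) | u v. f u = 0 \<and> f v = w} = {w}" for w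
      using fR[of w] by (auto simp: f_0 intro!: exI[of _ "R w"])
    moreover have "{f (u + v) | u v. f u = w \<and> f v = 0} = {w}" for w
      using fR[of w] by (auto simp: f_0 intro!: exI[of _ "R w"])
    ultimately show ?thesis using True by (cases "y = 0") (simp_all add: hyperadd_phase_def)
  next
    case False
    have fx: "f u = x \<longleftrightarrow> (\<exists>\<alpha>>0. u = of_real \<alpha> * R x)" for u
      using ex_f[of u x] False by simp
    have fy: "f u = y \<longleftrightarrow> (\<exists>\<beta>>0. u = of_real \<beta> * R y)" for u
      using ex_f[of u y] False by simp
    have xy: "{f (u + v) | u v. f u = x \<and> f v = y} =
        {f (of_real \<alpha> * R x + of_real \<beta> * R y) | \<alpha> \<beta>. \<alpha> > 0 \<and> \<beta> > 0}"
      unfolding fx fy by blast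
    show ?thesis
    proof (cases "y = - x")
      case True
      have eq: "f (of_real \<alpha> * R x + of_real \<beta> * R y) =
        (if \<alpha> = \<beta> then 0 else if \<alpha> > \<beta> then x else - x)" for \<alpha> \<beta>
      proof -
        have e: "of_real \<alpha> * R x + of_real \<beta> * R y = of_real (\<alpha> - \<beta>) * R x"
          using True by (simp add: R_minus algebra_simps)
        have e': "of_real (\<alpha> - \<beta>) * R x = - (of_real (\<beta> - \<alpha>) * R x)"
          by (simp add: algebra_simps)
        show ?thesis
          using f_scale[of "\<alpha> - \<beta>" "R x"] f_scale[of "\<beta> - \<alpha>" "R x"] fR[of x] f_0[of 0] 
          unfolding e by (cases \<alpha> \<beta> rule: linorder_cases) (simp_all add: e' f_minus del: of_real_diff)
      qed
      have "{if \<alpha> = \<beta> then 0 else if \<alpha> > \<beta> then x else - x | \<alpha> \<beta> :: real. \<alpha> > 0 \<and> \<beta> > 0} = {0, x, - x}"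
        (is "?L = _")
      proof
        have "0 \<in> ?L" by (intro CollectI exI[of _ 1]) auto
        moreover have "x \<in> ?L" by (intro CollectI exI[of _ 2] exI[of _ 1]) auto
        moreover have "- x \<in> ?L" by (intro CollectI exI[of _ 1] exI[of _ 2]) auto
        ultimately show "{0, x, - x} \<subseteq> ?L" by blast
      qed auto
      thus ?thesis unfolding xy eq using True False by (simp add: hyperadd_phase_def)
    next
      case neq: False
      have nz: "of_real \<alpha> * R x + of_real \<beta> * R y \<noteq> 0" if "\<alpha> > 0" "\<beta> > 0" for \<alpha> \<beta>
      proof
        assume "of_real \<alpha> * R x + of_real \<beta> * R y = 0"
        hence "of_real \<alpha> * R x = - (of_real \<beta> * R y)" by (simp add: eq_neg_iff_add_eq_0)
        hence "f (of_real \<alpha> * R x) = - f (of_real \<beta> * R y)" by (simp add: f_minus)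
        hence "x = - y" using that by (simp add: f_scale fR)
        thus False using neq R_minus R_inj by (metis minus_minus)
      qed
      have "{f (of_real \<alpha> * R x + of_real \<beta> * R y) | \<alpha> \<beta>. \<alpha> > 0 \<and> \<beta> > 0} =
        {z. \<exists>\<alpha> \<beta>. \<alpha> > 0 \<and> \<beta> > 0 \<and> R z = (of_real \<alpha> * R x + of_real \<beta> * R y) /
          of_real (cmod (of_real \<alpha> * R x + of_real \<beta> * R y))}"
      proof (intro Collect_cong iff_exI)
        fix z and \<alpha> \<beta> :: real
        let ?s = "of_real \<alpha> * R x + of_real \<beta> * R y"
        have "z = f ?s \<longleftrightarrow> R z = ?s / of_real (cmod ?s)" if "\<alpha> > 0" "\<beta> > 0"
          using nz[OF that] Rf[of ?s] R_inj[of z "f ?s"] by metis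
        thus "z = f ?s \<and> \<alpha> > 0 \<and> \<beta> > 0 \<longleftrightarrow> \<alpha> > 0 \<and> \<beta> > 0 \<and> R z = ?s / of_real (cmod ?s)"
          by blast
      qed
      thus ?thesis unfolding xy using False neq
        unfolding hyperadd_phase_def R_def[symmetric] by simp
    qed
  qed
  have memI: "f (u + v) \<in> x \<boxplus> y" if "f u = x" "f v = y" for u v x y
    using that unfolding add by blast
  have memE: "\<exists>u v. f u = x \<and> f v = y \<and> R z = u + v" if z: "z \<in> x \<boxplus> y" for x y z
  proof -
    from z obtain u v where uv: "f u = x" "f v = y" "z = f (u + v)"
      unfolding add by blast
    show ?thesis
    proof (cases "u + v = 0")
      case True
      thus ?thesis using uv by (intro exI[of _ u] exI[of _ v]) (simp add: Rf)
    next
      case False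
      define c where "c = 1 / cmod (u + v)"
      have "c > 0" using False by (simp add: c_def)
      moreover have "R z = of_real c * u + of_real c * v"
        using uv False by (simp add: Rf c_def add_divide_distrib)
      ultimately show ?thesis using uv f_scale by metis
    qed
  qed
  have memE': "\<exists>u v. f u = x \<and> f v = y \<and> s = u + v" if s: "f s \<in> x \<boxplus> y" for x y s
  proof (cases "s = 0")
    case True
    thus ?thesis using memE[OF s] by (simp add: Rf)
  next
    case False
    obtain u v where uv: "f u = x" "f v = y" "R (f s) = u + v"
      using memE[OF s] by blast
    have "s = of_real (cmod s) * u + of_real (cmod s) * v"
      using f_polar[of s] uv by (simp add: algebra_simps)
    moreover have "cmod s > 0" using False by simp
    ultimately show ?thesis using uv f_scale by metis
  qed
  have comm: "x \<boxplus> y = y \<boxplus> x" for x y :: phase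
    unfolding add by (metis (no_types, opaque_lifting) add.commute)
  have comm_Union: "(\<Union>w\<in>y \<boxplus> z. x \<boxplus> w) = (\<Union>w\<in>z \<boxplus> y. w \<boxplus> x)"
    for x y z :: phase
    by (intro arg_cong[of _ _ Union] image_cong comm)
  have assoc: "(\<Union>w\<in>x \<boxplus> y. w \<boxplus> z) \<subseteq> (\<Union>w\<in>y \<boxplus> z. x \<boxplus> w)" for x y z :: phase
  proof
    fix t assume "t \<in> (\<Union>w\<in>x \<boxplus> y. w \<boxplus> z)"
    then obtain w where w: "w \<in> x \<boxplus> y" "t \<in> w \<boxplus> z" by blast
    then obtain s r where sr: "f s = w" "f r = z" "R t = s + r" using memE by blast
    then obtain u v where uv: "f u = x" "f v = y" "s = u + v" using memE' w by blast
    have "f (u + (v + r)) \<in> x \<boxplus> f (v + r)" "f (v + r) \<in> y \<boxplus> z"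
      using uv sr by (auto intro: memI)
    moreover have "t = f (u + (v + r))" using sr uv fR[of t] by (simp add: add.assoc)
    ultimately show "t \<in> (\<Union>w\<in>y \<boxplus> z. x \<boxplus> w)" by blast
  qed
  fix x y z c :: phase
  show "(0 :: phase) \<noteq> 1" by transfer simp
  show "x * y * z = x * (y * z)" by transfer simp
  show "x * y = y * x" by transfer simp
  show "1 * x = x" by transfer simp
  show "0 * x = 0" by transfer simp
  show "x * 0 = 0" by transfer simp
  show "x \<boxplus> y \<noteq> {}" unfolding add using fR by blast
  show "x \<boxplus> y = y \<boxplus> x" by (rule comm)
  show "(\<Union>w\<in>x \<boxplus> y. w \<boxplus> z) = (\<Union>w\<in>y \<boxplus> z. x \<boxplus> w)"
  proof
    have "(\<Union>w\<in>y \<boxplus> z. x \<boxplus> w) = (\<Union>w\<in>z \<boxplus> y. w \<boxplus> x)"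
      by (rule comm_Union)
    also have "\<dots> \<subseteq> (\<Union>w\<in>y \<boxplus> x. z \<boxplus> w)" by (rule assoc)
    also have "\<dots> = (\<Union>w\<in>x \<boxplus> y. w \<boxplus> z)" by (rule comm_Union)
    finally show "(\<Union>w\<in>y \<boxplus> z. x \<boxplus> w) \<subseteq> (\<Union>w\<in>x \<boxplus> y. w \<boxplus> z)" .
  qed (rule assoc)
  show "x \<boxplus> 0 = {x}" by (simp add: hyperadd_phase_def)
  show "0 \<in> x \<boxplus> y \<longleftrightarrow> y = - x"
  proof
    assume "0 \<in> x \<boxplus> y"
    then obtain u v where uv: "f u = x" "f v = y" "R 0 = u + v" using memE by blast
    hence "v = - u" using R_0[of 0] by (simp add: eq_neg_iff_add_eq_0 add.commute)
    thus "y = - x" using uv f_minus by simp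
  next
    assume "y = - x"
    thus "0 \<in> x \<boxplus> y" using memI[of "R x" x "- R x" y] f_minus fR f_0[of 0] by simp
  qed
  show "y \<in> z \<boxplus> - x" if "z \<in> x \<boxplus> y"
  proof -
    obtain u v where uv: "f u = x" "f v = y" "R z = u + v" using memE \<open>z \<in> x \<boxplus> y\<close> by blast
    have "f (R z + (- u)) \<in> z \<boxplus> - x"
      by (rule memI[OF fR]) (simp add: f_minus uv)
    thus ?thesis using uv by simp
  qed
  show inv: "x \<noteq> 0 \<Longrightarrow> \<exists>y. x * y = 1"
  proof (intro exI)
    assume "x \<noteq> 0"
    have "f 1 = 1" by (rule R_inj) (simp add: Rf, simp add: R_def one_phase.rep_eq)
    thus "x * f (inverse (R x)) = 1"
      using f_mult[of "R x" "inverse (R x)"] fR R_0 \<open>x \<noteq> 0\<close> by simp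
  qed
  show "(\<lambda>w. c * w) ` (x \<boxplus> y) = c * x \<boxplus> c * y"
  proof (cases "c = 0")
    case True
    have "0 * w = 0" for w :: phase by transfer simp
    moreover have "x \<boxplus> y \<noteq> {}" unfolding add using fR by blast
    ultimately show ?thesis using True by (auto simp: hyperadd_phase_def)
  next
    case False
    show ?thesis
    proof (intro equalityI subsetI)
      fix t assume "t \<in> (\<lambda>w. c * w) ` (x \<boxplus> y)"
      then obtain u v where uv: "f u = x" "f v = y" "t = c * f (u + v)"
        unfolding add by auto
      hence "t = f (R c * u + R c * v)" using f_mult[of "R c" "u + v"] fR
        by (simp add: algebra_simps)
      moreover have "f (R c * u) = c * x" "f (R c * v) = c * y" using f_mult fR uv by auto
      ultimately show "t \<in> c * x \<boxplus> c * y" using memI by auto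
    next
      fix t assume "t \<in> c * x \<boxplus> c * y"
      then obtain u v where uv: "f u = c * x" "f v = c * y" "R t = u + v" using memE by blast
      define d where "d = inverse (R c)"
      have d: "R c * d = 1" using False R_0 by (simp add: d_def)
      have dc: "f d * (c * w) = w" for w
        using f_mult[of d "R c * R w"] f_mult[of "R c" "R w"] fR d
        by (metis mult.assoc mult.commute mult.left_neutral)
      have "f (d * u) = x" "f (d * v) = y" using uv f_mult dc by auto
      hence "f (d * u + d * v) \<in> x \<boxplus> y" by (rule memI)
      moreover have "c * f (d * u + d * v) = t"
      proof -
        have "c * f (d * u + d * v) = f (R c * (d * u + d * v))" using f_mult fR by simp
        also have "R c * (d * u + d * v) = R c * d * (u + v)" by (simp add: algebra_simps)
        also have "\<dots> = R t" using d uv by simp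
        finally show ?thesis using fR by simp
      qed
      ultimately show "t \<in> (\<lambda>w. c * w) ` (x \<boxplus> y)" by blast
    qed
  qed
qed

end

lemma phase_of_pos: "c > 0 \<Longrightarrow> phase_of (of_real c) = 1"
  by transfer auto

lemma hyperfield_hom_phase_of: "hyperfield_hom phase_of"
  unfolding hyperfield_hom_def
proof (intro conjI allI)
  show mult: "phase_of (x * y) = phase_of x * phase_of y" for x y
    by transfer (simp add: norm_mult)
  show "phase_of 0 = 0" "phase_of 1 = 1" by (transfer, simp)+
  fix x y :: complex
  let ?X = "Rep_phase (phase_of x)" and ?Y = "Rep_phase (phase_of y)"
  have zero: "phase_of z = 0 \<longleftrightarrow> z = 0" for z
    by transfer auto
  have polar: "of_real (cmod z) * Rep_phase (phase_of z) = z" for z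
    by (simp add: phase_of.rep_eq)
  have "phase_of (x + y) \<in> phase_of x \<boxplus> phase_of y"
  proof (cases "x = 0 \<or> y = 0")
    case True
    thus ?thesis using zero by (auto simp: hyperadd_phase_def)
  next
    case False
    hence nz: "x \<noteq> 0" "y \<noteq> 0" "cmod x > 0" "cmod y > 0" by auto
    show ?thesis
    proof (cases "phase_of y = - phase_of x")
      case True
      hence "?Y = - ?X" by (simp add: uminus_phase.rep_eq)
      moreover have "x + y = of_real (cmod x) * ?X + of_real (cmod y) * ?Y"
        unfolding polar ..
      ultimately have "x + y = of_real (cmod x - cmod y) * ?X"
        by (simp add: algebra_simps)
      moreover have "phase_of ?X = phase_of x"
        using mult[of "of_real (cmod x)" ?X] phase_of_pos[OF nz(3)] unfolding polar by simp
      ultimately have eq: "phase_of (x + y) = phase_of (of_real (cmod x - cmod y)) * phase_of x"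
        by (simp only: mult)
      have "phase_of (of_real (cmod x - cmod y)) \<in> {0, 1, - 1}"
        by transfer (auto simp: divide_simps simp flip: of_real_diff split: abs_split)
      moreover have "- 1 * phase_of x = - phase_of x" by transfer simp
      ultimately have "phase_of (x + y) \<in> {0, phase_of x, - phase_of x}"
        unfolding eq by auto
      moreover have "phase_of x \<noteq> 0" "phase_of y \<noteq> 0" using zero nz by simp_all
      hence "phase_of x \<boxplus> phase_of y = {0, phase_of x, - phase_of x}"
        unfolding hyperadd_phase_def using True by metis
      ultimately show ?thesis by simp
    next
      case neq: False
      have "x + y \<noteq> 0"
      proof
        assume "x + y = 0"
        hence "y = - x" by (simp add: add_eq_0_iff)
        moreover have "phase_of (- x) = - phase_of x" by transfer auto
        ultimately show False using neq by simp
      qed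
      hence "Rep_phase (phase_of (x + y)) =
          (of_real (cmod x) * ?X + of_real (cmod y) * ?Y) /
            of_real (cmod (of_real (cmod x) * ?X + of_real (cmod y) * ?Y))"
        unfolding polar by (simp add: phase_of.rep_eq)
      hence "\<exists>\<alpha> \<beta> :: real. \<alpha> > 0 \<and> \<beta> > 0 \<and> Rep_phase (phase_of (x + y)) =
          (of_real \<alpha> * ?X + of_real \<beta> * ?Y) / of_real (cmod (of_real \<alpha> * ?X + of_real \<beta> * ?Y))"
        using nz by blast
      moreover have "phase_of x \<noteq> 0" "phase_of y \<noteq> 0" using zero nz by simp_all
      ultimately show ?thesis using neq unfolding hyperadd_phase_def by simp
    qed
  qed
  thus "phase_of ` (x \<boxplus> y) \<subseteq> phase_of x \<boxplus> phase_of y"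
    by (simp add: hyperadd_complex_def)
qed

definition p_bar :: "phase poly" where
  "p_bar = [:phase_cis (23 * pi / 24), phase_cis (pi / 2), phase_cis (pi / 24), 1:]"

end

(* Divide by T + 1 repeatedly: three divisions would force the constant coefficient of p_bar to be 1,
   while T^2 + e^(i pi/4) T + e^(23 i pi/24) is a quotient of p_bar that still has the root -1.
   Over the complex numbers, suppose that p = (T + s) (T + t) (r T + w) with s, t, r > 0. The phases
   of the coefficients of T^0 and T^2 give 2 Re w = - r (s + t), and the coefficient of T^1 being
   purely imaginary then gives s^2 + t^2 = 0. *)

theory Submission
  imports Defs
begin

section \<open>Multiplicities over an arbitrary hyperfield\<close>

lemma hmult_ge_Suc:
  assumes "p \<noteq> 0" "hyperroot p a" "p \<in> [:- a, 1:] \<boxdot> q"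
  shows "hmult a p \<ge> Suc (hmult a q)"
proof -
  have "hmult a q \<le> Max (hmult a ` {q. p \<in> [:- a, 1:] \<boxdot> q})"
    using assms finite_hmult_image by (intro Max_ge) auto
  thus ?thesis
    using assms by (subst hmult.simps) simp
qed

lemma hmult_eq_SucD:
  assumes "hmult a p = Suc n"
  shows "p \<noteq> 0 \<and> hyperroot p a \<and> (\<exists>q. p \<in> [:- a, 1:] \<boxdot> q \<and> hmult a q = n)"
proof -
  have p: "p \<noteq> 0" "hyperroot p a"
    using assms hmult.simps[of a p] by (auto split: if_splits)
  let ?S = "hmult a ` {q. p \<in> [:- a, 1:] \<boxdot> q}"
  have "Max ?S = n"
    using assms hmult.simps[of a p] p by simp
  moreover have "Max ?S \<in> ?S"
    using finite_hmult_image[OF p(1)] hyperroot_imp_factor[OF p(2)] by (intro Max_in) auto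
  ultimately show ?thesis
    using p by auto
qed

text \<open>Full multiplicity means that one can divide by T - a until only a constant is left.
  Hypersums are multivalued, but the two extreme coefficients of a product with T - a are not: each
  division keeps the leading coefficient and takes one factor - a out of the constant
  coefficient.\<close>

lemma coeff_0_if_hmult_eq_degree:
  fixes p :: "'a :: hyperfield poly"
  assumes "hmult a p = degree p"
  shows "coeff p 0 = (- a) ^ degree p * lead_coeff p"
  using assms
proof (induction "degree p" arbitrary: p)
  case 0
  thus ?case by simp
next
  case (Suc n)
  then obtain q where q: "p \<in> [:- a, 1:] \<boxdot> q" "hmult a q = n" "p \<noteq> 0"
    using hmult_eq_SucD[of a p n] by auto
  have deg: "degree q = n"
    using hyperprod_linear_degree[OF q(1,3)] Suc.hyps by simp
  hence IH: "coeff q 0 = (- a) ^ n * lead_coeff q"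
    using Suc.hyps(1)[of q] q by simp
  have "coeff p (Suc n) \<in> - a * coeff q (Suc n) \<boxplus> coeff q n" "coeff p 0 = - a * coeff q 0"
    using q(1) by (simp_all add: hyperprod_linear_iff)
  thus ?case
    using IH deg Suc.hyps(2)[symmetric] by (simp add: coeff_eq_0 mult.assoc)
qed

section \<open>Phases as angles, and the multiplicity of -1 in \<open>p_bar\<close>\<close>

lemma phase_cis_in_hyperadd:
  assumes "a < b" "b < c" "c < a + pi"
  shows "phase_cis b \<in> phase_cis a \<boxplus> phase_cis c"
proof -
  have nz: "phase_cis t \<noteq> 0" for t
    by transfer simp
  have pos: "sin (c - b) > 0" "sin (b - a) > 0" "sin (c - a) > 0"
    using assms by (auto intro!: sin_gt_zero)
  have neq: "phase_cis c \<noteq> - phase_cis a"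
  proof
    assume "phase_cis c = - phase_cis a"
    hence eq: "cis c = - cis a"
      by transfer simp
    hence "cos c = - cos a" "sin c = - sin a"
      by (auto simp: complex_eq_iff)
    hence "sin (c - a) = 0"
      by (simp add: sin_diff)
    thus False using pos by simp
  qed
  \<comment> \<open>The positive weights that the hyperaddition asks for come from the law of sines
    in the triangle with sides in the directions a, b and c.\<close>
  have eq: "of_real (sin (c - b)) * cis a + of_real (sin (b - a)) * cis c
              = of_real (sin (c - a)) * cis b"
  proof -
    have "(sin c * cos b - cos c * sin b) * cos a + (sin b * cos a - cos b * sin a) * cos c
            = (sin c * cos a - cos c * sin a) * cos b"
         "(sin c * cos b - cos c * sin b) * sin a + (sin b * cos a - cos b * sin a) * sin c
            = (sin c * cos a - cos c * sin a) * sin b"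
      by algebra+
    thus ?thesis
      by (simp add: complex_eq_iff sin_diff)
  qed
  have "Rep_phase (phase_cis b) =
      (of_real (sin (c - b)) * Rep_phase (phase_cis a) + of_real (sin (b - a)) * Rep_phase (phase_cis c)) /
      of_real (cmod (of_real (sin (c - b)) * Rep_phase (phase_cis a) +
        of_real (sin (b - a)) * Rep_phase (phase_cis c)))"
    using pos by (simp add: phase_cis.rep_eq eq norm_mult)
  thus ?thesis
    using nz neq pos unfolding hyperadd_phase_def by auto
qed

lemma phase_cis_0: "phase_cis 0 = 1"
  by transfer simp

text \<open>Turning by - pi instead of pi leaves the angles below in the increasing order, within a
  half turn, that \<open>phase_cis_in_hyperadd\<close> expects.\<close>

lemma minus_phase_cis: "- phase_cis t = phase_cis (t - pi)"
  by transfer (simp add: complex_eq_iff)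

lemma phase_minus_minus: "- (- x) = (x :: phase)"
  by transfer simp

lemma phase_mult_minus_1: "x * - 1 = - (x :: phase)"
  by transfer simp

lemma hmult_p_bar: "hmult (- 1) p_bar = 2"
proof (rule antisym)
  have deg: "degree p_bar = 3"
    by (simp add: p_bar_def)
  have "hmult (- 1) p_bar \<noteq> 3"
  proof
    assume "hmult (- 1) p_bar = 3"
    hence "coeff p_bar 0 = 1"
      using coeff_0_if_hmult_eq_degree[of "- 1" p_bar] deg
      by (simp add: phase_minus_minus) (simp add: p_bar_def numeral_3_eq_3)
    hence "phase_cis (23 * pi / 24) = 1"
      by (simp add: p_bar_def)
    hence "cis (23 * pi / 24) = 1"
      by transfer simp
    hence "sin (23 * pi / 24) = 0"
      by (simp add: complex_eq_iff)
    moreover have "sin (23 * pi / 24) > 0"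
      by (rule sin_gt_zero) auto
    ultimately show False by simp
  qed
  thus "hmult (- 1) p_bar \<le> 2"
    using hmult_le_degree[of "- 1" p_bar] deg by linarith
next
  \<comment> \<open>Any middle angle strictly between pi / 24 and pi / 2 would do: it has to exceed
    pi / 24 for the coefficient of T^2 and stay below pi / 2 for that of T.\<close>
  define q where "q = [:phase_cis (23 * pi / 24), phase_cis (pi / 4), 1:]"
  have q: "p_bar \<in> [:- (- 1), 1:] \<boxdot> q"
    unfolding hyperprod_linear_iff phase_minus_minus
  proof (intro conjI allI)
    show "coeff p_bar 0 = 1 * coeff q 0"
      by (simp add: p_bar_def q_def)
  next
    fix i
    have "phase_cis (pi / 2) \<in> phase_cis (pi / 4) \<boxplus> phase_cis (23 * pi / 24)"
      by (rule phase_cis_in_hyperadd) auto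
    moreover have "phase_cis (pi / 24) \<in> phase_cis 0 \<boxplus> phase_cis (pi / 4)"
      by (rule phase_cis_in_hyperadd) auto
    ultimately show "coeff p_bar (Suc i) \<in> 1 * coeff q (Suc i) \<boxplus> coeff q i"
      by (auto simp: p_bar_def q_def phase_cis_0 coeff_pCons split: nat.split)
  qed
  have p_root: "hyperroot p_bar (- 1)"
  proof -
    \<comment> \<open>At -1 the terms are c0, - c1, c2 and -1. The nested hypersum contains 0 once -
      c0 lies in - c1 \<boxplus> y for some y in c2 \<boxplus> (-1); the angle pi / 4 provides such
      a y.\<close>
    have "- phase_cis (23 * pi / 24) \<in> - phase_cis (pi / 2) \<boxplus> phase_cis (pi / 4)"
      unfolding minus_phase_cis using pi_gt_zero by (intro phase_cis_in_hyperadd) linarith+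
    moreover have "phase_cis (pi / 4) \<in> phase_cis (pi / 24) \<boxplus> phase_cis pi"
      by (rule phase_cis_in_hyperadd) auto
    moreover have "phase_cis pi = - 1"
      by transfer simp
    ultimately show ?thesis
      by (auto simp: hyperroot_def p_bar_def zero_in_hyperadd_iff phase_mult_minus_1
          phase_minus_minus numeral_3_eq_3 numeral_2_eq_2)
  qed
  have q_root: "hyperroot q (- 1)"
  proof -
    have "- phase_cis (23 * pi / 24) \<in> - phase_cis (pi / 4) \<boxplus> phase_cis 0"
      unfolding minus_phase_cis using pi_gt_zero by (intro phase_cis_in_hyperadd) linarith+
    thus ?thesis
      by (auto simp: hyperroot_def q_def zero_in_hyperadd_iff phase_mult_minus_1 phase_cis_0
          phase_minus_minus)
  qed
  have "q \<noteq> 0"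
    by (simp add: q_def)
  have "hmult (- 1) q \<ge> 1"
    using hyperroot_imp_factor[OF q_root] hmult_ge_Suc[OF \<open>q \<noteq> 0\<close> q_root] by fastforce
  moreover have "hmult (- 1) p_bar \<ge> Suc (hmult (- 1) q)"
    by (rule hmult_ge_Suc[OF _ p_root q]) (simp add: p_bar_def)
  ultimately show "2 \<le> hmult (- 1) p_bar"
    by linarith
qed

section \<open>Negative real roots of the complex lifts\<close>

lemma phase_of_eq_0_iff: "phase_of z = 0 \<longleftrightarrow> z = 0"
  by transfer auto

lemma phase_of_eq_phase_cisD:
  assumes "phase_of z = phase_cis t"
  shows "z = of_real (cmod z) * cis t"
  using assms by transfer (auto simp: field_simps split: if_splits)

lemma phase_of_eq_minus_1_iff: "phase_of z = - 1 \<longleftrightarrow> (\<exists>r<0. z = of_real r)"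
proof
  assume "phase_of z = - 1"
  hence "z \<noteq> 0 \<and> z = of_real (- cmod z)"
    by transfer (auto simp: field_simps split: if_splits)
  thus "\<exists>r<0. z = of_real r"
    by (intro exI[of _ "- cmod z"]) auto
next
  assume "\<exists>r<0. z = of_real r"
  then obtain r where "r < 0" "z = of_real r" by blast
  thus "phase_of z = - 1"
    by transfer auto
qed

text \<open>Reduces counting with multiplicity to divisibility by two linear factors. They coincide
  if a single root has order at least 2, and otherwise belong to two distinct roots.\<close>

lemma two_roots_dvd:
  fixes p :: "'a :: field poly"
  assumes "(\<Sum>a\<in>A. order a p) \<ge> 2"
  shows "\<exists>a\<in>A. \<exists>b\<in>A. [:- a, 1:] * [:- b, 1:] dvd p"
proof (cases "\<exists>a\<in>A. order a p \<ge> 2")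
  case True
  then obtain a where a: "a \<in> A" "order a p \<ge> 2" by blast
  hence "[:- a, 1:] ^ 2 dvd p"
    using order_1[of a p] le_imp_power_dvd dvd_trans by blast
  thus ?thesis
    using a(1) unfolding power2_eq_square by blast
next
  case False
  \<comment> \<open>A sum over an infinite set is 0 by convention, which the bound excludes.\<close>
  have fin: "finite A"
    using assms by (rule contrapos_pp) simp
  have "\<exists>a\<in>A. order a p \<noteq> 0"
    using assms by (rule contrapos_pp) simp
  then obtain a where a: "a \<in> A" "order a p \<noteq> 0" by blast
  have "\<not> order a p \<ge> 2"
    using False a(1) by blast
  hence "(\<Sum>b\<in>A - {a}. order b p) \<noteq> 0"
    using assms sum.remove[OF fin a(1), of "\<lambda>a. order a p"] by linarith
  then obtain b where b: "b \<in> A" "b \<noteq> a" "order b p \<noteq> 0"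
    by (metis DiffE insertI1 sum.neutral)
  obtain q where q: "p = [:- a, 1:] * q"
    using a(2) order_root poly_eq_0_iff_dvd dvdE by metis
  have "poly p b = 0"
    using b(3) order_root by blast
  hence "[:- b, 1:] dvd q"
    using b(2) q by (simp add: poly_eq_0_iff_dvd[symmetric])
  hence "[:- a, 1:] * [:- b, 1:] dvd p"
    unfolding q by (rule mult_dvd_mono[OF dvd_refl])
  thus ?thesis
    using a(1) b(1) by blast
qed

lemma no_two_negative_roots:
  fixes p :: "complex poly" and a b :: real
  assumes p: "map_poly phase_of p = p_bar"
    and neg: "a < 0" "b < 0"
  shows "\<not> [:- of_real a, 1:] * [:- of_real b, 1:] dvd p"
proof
  assume "[:- of_real a, 1:] * [:- of_real b, 1:] dvd p"
  then obtain q where q: "p = [:- of_real a, 1:] * [:- of_real b, 1:] * q"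
    by blast
  have "degree p = 3"
  proof -
    have "degree (map_poly phase_of p) = degree p"
      by (rule degree_map_poly) (simp add: phase_of_eq_0_iff)
    thus ?thesis
      unfolding p by (simp add: p_bar_def)
  qed
  moreover have "q \<noteq> 0"
    using \<open>degree p = 3\<close> q by auto
  ultimately have "degree q = 1"
    using q by (simp add: degree_mult_eq del: mult_pCons_left)
  then obtain w r where wr: "q = [:w, r:]"
    using degree1_coeffs[of q] by metis
  define s t where "s = - a" and "t = - b"
  have st: "s > 0" "t > 0"
    using neg by (simp_all add: s_def t_def)
  have p_eq: "p = [:of_real (s * t) * w, of_real (s + t) * w + of_real (s * t) * r,
                    w + of_real (s + t) * r, r:]"
    unfolding q wr by (simp add: s_def t_def algebra_simps)
  have coeff: "phase_of (coeff p i) = coeff p_bar i" for i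
    unfolding p[symmetric] by (simp add: coeff_map_poly phase_of_eq_0_iff)
  \<comment> \<open>The phases of the coefficients of T^0 and T^2 are mirror images in the imaginary
    axis, so the same two numbers describe both.\<close>
  define k h where "k = cos (pi / 24)" and "h = sin (pi / 24)"
  have h: "h > 0"
    unfolding h_def by (rule sin_gt_zero) auto
  have cis_23: "cis (23 * pi / 24) = Complex (- k) h"
  proof -
    have "23 * pi / 24 = pi - pi / 24" by simp
    thus ?thesis
      unfolding k_def h_def by (simp only: complex_eq_iff cis.sel complex.sel cos_pi_minus sin_pi_minus)
  qed
  \<comment> \<open>Turns phases into linear equations between real and imaginary parts, from which
    the scalars \<open>m0\<close> and \<open>m2\<close> are then eliminated.\<close>
  have phase: "\<exists>m. coeff p i = of_real m * cis \<theta>" if "coeff p_bar i = phase_cis \<theta>" for i \<theta>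
    using phase_of_eq_phase_cisD[of "coeff p i" \<theta>] coeff[of i] that by auto
  obtain m0 where "coeff p 0 = of_real m0 * cis (23 * pi / 24)"
    using phase[of 0 "23 * pi / 24"] by (auto simp: p_bar_def)
  hence m0: "s * t * Re w = - m0 * k" "s * t * Im w = m0 * h"
    by (simp_all add: p_eq cis_23 complex_eq_iff)
  obtain m1 where "coeff p 1 = of_real m1 * cis (pi / 2)"
    using phase[of 1 "pi / 2"] by (auto simp: p_bar_def)
  hence m1: "(s + t) * Re w + s * t * Re r = 0"
    by (simp add: p_eq complex_eq_iff)
  obtain m2 where "coeff p 2 = of_real m2 * cis (pi / 24)"
    using phase[of 2 "pi / 24"] by (auto simp: p_bar_def numeral_2_eq_2)
  hence m2: "Re w + (s + t) * Re r = m2 * k" "Im w + (s + t) * Im r = m2 * h"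
    by (simp_all add: p_eq numeral_2_eq_2 complex_eq_iff k_def h_def)
  have "r = of_real (cmod r)"
    using phase_of_eq_phase_cisD[of "coeff p 3" 0] coeff[of 3]
    by (auto simp: p_eq p_bar_def numeral_3_eq_3 phase_cis_0)
  moreover have "r \<noteq> 0"
    using wr \<open>degree q = 1\<close> by auto
  ultimately have r: "Re r > 0" "Im r = 0"
    by (metis Re_complex_of_real zero_less_norm_iff, metis Im_complex_of_real)
  have "s * t * (Re w * h + Im w * k) = 0"
    using m0 by algebra
  hence "Re w * h + Im w * k = 0"
    using st by simp
  \<comment> \<open>Both sides equal \<open>m2 * h * k\<close>, because \<open>r\<close> is
    real.\<close>
  moreover have "(Re w + (s + t) * Re r) * h = Im w * k"
    using m2 r(2) by simp
  ultimately have "(2 * Re w + (s + t) * Re r) * h = 0"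
    by algebra
  hence "2 * Re w + (s + t) * Re r = 0"
    using h by simp
  \<comment> \<open>Twice \<open>m1\<close> minus (s + t) times the previous equation gives (2 s t -
    (s + t)^2) \<open>Re r\<close> = 0.\<close>
  hence "(s\<^sup>2 + t\<^sup>2) * Re r = 0"
    using m1 by algebra
  thus False
    using st r(1) by (simp add: sum_power2_eq_zero_iff)
qed

lemma sum_order_less_2:
  assumes "map_poly phase_of p = p_bar"
  shows "(\<Sum>a | phase_of a = - 1 \<and> poly p a = 0. order a p) < 2"
proof (rule ccontr)
  assume "\<not> ?thesis"
  then obtain a b where "phase_of a = - 1" "phase_of b = - 1" "[:- a, 1:] * [:- b, 1:] dvd p"
    using two_roots_dvd[of p "{a. phase_of a = - 1 \<and> poly p a = 0}"] by auto
  thus False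
    using no_two_negative_roots[OF assms] by (auto simp: phase_of_eq_minus_1_iff)
qed

text \<open>The fibre of \<open>phase_of\<close> over -1 is the negative real axis. Hence a single
  bound settles both the inequality and the failure of equality in the theorem.\<close>

lemma sum_order_negative_real_roots:
  "(\<Sum>a :: real | a < 0 \<and> poly p (of_real a) = 0. order (of_real a) p) =
     (\<Sum>a | phase_of a = - 1 \<and> poly p a = 0. order a p)"
proof -
  have "{a. phase_of a = - 1 \<and> poly p a = 0} = of_real ` {a :: real. a < 0 \<and> poly p (of_real a) = 0}"
    by (auto simp: phase_of_eq_minus_1_iff)
  thus ?thesis
    by (simp add: sum.reindex inj_on_def)
qed

theorem mainTheorem2:
  shows "hmult (- 1) p_bar = 2 \<and>
    (\<forall>p :: complex poly. map_poly phase_of p = p_bar \<longrightarrow>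
       hmult (- 1) p_bar >
         (\<Sum>a :: real | a < 0 \<and> poly p (of_real a) = 0. order (of_real a) p)) \<and>
    \<not> (\<exists>p :: complex poly. map_poly phase_of p = p_bar \<and>
       hmult (- 1) p_bar = (\<Sum>a | phase_of a = - 1 \<and> poly p a = 0. order a p))"
  unfolding hmult_p_bar sum_order_negative_real_roots
proof (intro conjI allI impI notI)
  show "(\<Sum>a | phase_of a = - 1 \<and> poly p a = 0. order a p) < 2"
    if "map_poly phase_of p = p_bar" for p
    using that by (rule sum_order_less_2)
  show False
    if "\<exists>p. map_poly phase_of p = p_bar \<and> 2 = (\<Sum>a | phase_of a = - 1 \<and> poly p a = 0. order a p)"
    using that sum_order_less_2 by fastforce
qed (rule refl)

end
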